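(* Let $F$ be a field, let $n\in\{2,3\}$, let $A=(a_{ijk})_{1\le i,j,k\le n}$ be a cubic-matrix of order $n$ over $F$, and let $B$ be the cubic-matrix of order $n$ obtained from $A$ by interchanging two consecutive horizontal layers, i.e. the layers $i=m$ and $i=m+1$ for some $m\in\{1,\dots,n-1\}$. Then $\det(A)=\det(B)$, where $\det$ denotes the determinant of cubic-matrices of order 2 and 3 defined in the context.
   Context: A cubic-matrix of order $n$ over a field $F$ is a family $A=(a_{ijk})_{1\le i,j,k\le n}$ with $a_{ijk}\in F$. Fixing the index $i$ gives a "horizontal layer". For a cubic-matrix $A$ of order 2 the determinant is the scalar $$\det(A)=a_{111}a_{222}-a_{112}a_{221}-a_{121}a_{212}+a_{122}a_{211}.$$ For a cubic-matrix $A$ of order 3 the determinant is the scalar $$\begin{aligned}\det(A)={}&a_{111}a_{222}a_{333}-a_{111}a_{232}a_{323}-a_{111}a_{223}a_{332}+a_{111}a_{233}a_{322}\\ &-a_{112}a_{221}a_{333}+a_{112}a_{223}a_{331}+a_{112}a_{231}a_{323}-a_{112}a_{233}a_{321}\\ &+a_{113}a_{221}a_{332}-a_{113}a_{222}a_{331}-a_{113}a_{231}a_{322}+a_{113}a_{232}a_{321}\\ &-a_{121}a_{212}a_{333}+a_{121}a_{213}a_{332}+a_{121}a_{232}a_{313}-a_{121}a_{233}a_{312}\\ &+a_{122}a_{211}a_{333}-a_{122}a_{213}a_{331}-a_{122}a_{231}a_{313}+a_{122}a_{233}a_{311}\\ &-a_{123}a_{211}a_{332}+a_{123}a_{212}a_{331}+a_{123}a_{231}a_{312}-a_{123}a_{232}a_{311}\\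 &+a_{131}a_{212}a_{323}-a_{131}a_{213}a_{322}-a_{131}a_{222}a_{313}+a_{131}a_{223}a_{312}\\ &-a_{132}a_{211}a_{323}+a_{132}a_{213}a_{321}+a_{132}a_{221}a_{313}-a_{132}a_{223}a_{311}\\ &+a_{133}a_{211}a_{322}-a_{133}a_{212}a_{321}-a_{133}a_{221}a_{312}+a_{133}a_{222}a_{311}.\end{aligned}$$ *)

theory Defs
  imports Main "HOL-Combinatorics.Transposition"
begin

text \<open>
  A cubic-matrix of order \<open>n\<close> is represented by a total function of its three indices
  \<open>i\<close>, \<open>j\<close>, \<open>k\<close>; only its values on indices in \<open>{1..n}\<close> are meaningful, and the
  determinant of order \<open>n\<close> reads no others.
\<close>

type_synonym 'a cubic_matrix = "nat \<Rightarrow> nat \<Rightarrow> nat \<Rightarrow> 'a"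

definition cubic_det2 :: "'a::field cubic_matrix \<Rightarrow> 'a" where
  "cubic_det2 a =
     a 1 1 1 * a 2 2 2 - a 1 1 2 * a 2 2 1 - a 1 2 1 * a 2 1 2 + a 1 2 2 * a 2 1 1"

definition cubic_det3 :: "'a::field cubic_matrix \<Rightarrow> 'a" where
  "cubic_det3 a =
     a 1 1 1 * a 2 2 2 * a 3 3 3 - a 1 1 1 * a 2 3 2 * a 3 2 3 - a 1 1 1 * a 2 2 3 * a 3 3 2 + a 1 1 1 * a 2 3 3 * a 3 2 2
     - a 1 1 2 * a 2 2 1 * a 3 3 3 + a 1 1 2 * a 2 2 3 * a 3 3 1 + a 1 1 2 * a 2 3 1 * a 3 2 3 - a 1 1 2 * a 2 3 3 * a 3 2 1
     + a 1 1 3 * a 2 2 1 * a 3 3 2 - a 1 1 3 * a 2 2 2 * a 3 3 1 - a 1 1 3 * a 2 3 1 * a 3 2 2 + a 1 1 3 * a 2 3 2 * a 3 2 1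
     - a 1 2 1 * a 2 1 2 * a 3 3 3 + a 1 2 1 * a 2 1 3 * a 3 3 2 + a 1 2 1 * a 2 3 2 * a 3 1 3 - a 1 2 1 * a 2 3 3 * a 3 1 2
     + a 1 2 2 * a 2 1 1 * a 3 3 3 - a 1 2 2 * a 2 1 3 * a 3 3 1 - a 1 2 2 * a 2 3 1 * a 3 1 3 + a 1 2 2 * a 2 3 3 * a 3 1 1
     - a 1 2 3 * a 2 1 1 * a 3 3 2 + a 1 2 3 * a 2 1 2 * a 3 3 1 + a 1 2 3 * a 2 3 1 * a 3 1 2 - a 1 2 3 * a 2 3 2 * a 3 1 1
     + a 1 3 1 * a 2 1 2 * a 3 2 3 - a 1 3 1 * a 2 1 3 * a 3 2 2 - a 1 3 1 * a 2 2 2 * a 3 1 3 + a 1 3 1 * a 2 2 3 * a 3 1 2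
     - a 1 3 2 * a 2 1 1 * a 3 2 3 + a 1 3 2 * a 2 1 3 * a 3 2 1 + a 1 3 2 * a 2 2 1 * a 3 1 3 - a 1 3 2 * a 2 2 3 * a 3 1 1
     + a 1 3 3 * a 2 1 1 * a 3 2 2 - a 1 3 3 * a 2 1 2 * a 3 2 1 - a 1 3 3 * a 2 2 1 * a 3 1 2 + a 1 3 3 * a 2 2 2 * a 3 1 1"

text \<open>The determinant is only considered for orders 2 and 3.\<close>

definition cubic_det :: "nat \<Rightarrow> 'a::field cubic_matrix \<Rightarrow> 'a" where
  "cubic_det n a =
     (if n = 2 then cubic_det2 a else if n = 3 then cubic_det3 a else undefined)"

text \<open>The horizontal layer \<open>i\<close> consists of the entries whose first index is \<open>i\<close>.\<close>

definition swap_horizontal_layers :: "nat \<Rightarrow> nat \<Rightarrow> 'a cubic_matrix \<Rightarrow> 'a cubic_matrix" where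
  "swap_horizontal_layers p q a = (\<lambda>i j k. a (Transposition.transpose p q i) j k)"

end

theory Submission
  imports Defs
begin

text \<open>Both determinants are sums over pairs of permutations (s, t) of
  \<open>sgn s * sgn t\<close> times the product over i of \<open>a i (s i) (t i)\<close>. Swapping
  two layers composes s and t with the same transposition: both signs flip, their product stays, and
  the terms are only permuted. With so few terms, each swap is checked by expanding and
  reordering.\<close>

lemma cubic_det2_swap_layers_1_2:
  "cubic_det2 (swap_horizontal_layers 1 2 a) = cubic_det2 a"
  by (simp add: cubic_det2_def swap_horizontal_layers_def transpose_def algebra_simps)

lemma cubic_det3_swap_layers_1_2:
  "cubic_det3 (swap_horizontal_layers 1 2 a) = cubic_det3 a"
  by (simp add: cubic_det3_def swap_horizontal_layers_def transpose_def algebra_simps)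

lemma cubic_det3_swap_layers_2_3:
  "cubic_det3 (swap_horizontal_layers 2 3 a) = cubic_det3 a"
  by (simp add: cubic_det3_def swap_horizontal_layers_def transpose_def algebra_simps)

theorem theorem2:
  fixes A B :: "'a::field cubic_matrix" and n m :: nat
  assumes "n \<in> {2, 3}"
    and "m \<in> {1..n - 1}"
    and "B = swap_horizontal_layers m (m + 1) A"
  shows "cubic_det n A = cubic_det n B"
proof -
  consider "n = 2" "m = 1" | "n = 3" "m = 1" | "n = 3" "m = 2"
    using assms(1,2) by fastforce
  then show ?thesis
  proof cases
    case 1
    then show ?thesis
      \<comment> \<open>With \<open>m = 1\<close>, simp turns \<open>m + 1\<close> into
        \<open>Suc (Suc 0)\<close>; \<open>numeral_2_eq_2\<close> brings the 2 of the lemma to that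
        form.\<close>
      using cubic_det2_swap_layers_1_2[of A] assms(3) by (simp add: cubic_det_def numeral_2_eq_2)
  next
    case 2
    then show ?thesis
      using cubic_det3_swap_layers_1_2[of A] assms(3) by (simp add: cubic_det_def numeral_2_eq_2)
  next
    case 3
    then show ?thesis
      using cubic_det3_swap_layers_2_3[of A] assms(3) by (simp add: cubic_det_def)
  qed
qed

end
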